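(* Let $K$ be a field of characteristic $0$, and let $\mathcal{A}s_3\langle X\rangle$ be the free third-type associative algebra over $K$ generated by the set $X$. Let $\mathcal{A}s_3^{(+)}\langle X\rangle$ be the same vector space with the anti-commutator operation $\{a,b\}=ab+ba$. Then all identities of the algebra $\mathcal{A}s_3^{(+)}\langle X\rangle$ up to degree $4$ follow from commutativity $\{a,b\}=\{b,a\}$ and the following identities (which hold in $\mathcal{A}s_3^{(+)}\langle X\rangle$): $$\{\{\{a,b\},c\},d\}=\{\{\{a,c\},b\},d\}$$ and $$\{\{\{a,b\},c\},d\}=\{\{\{a,b\},d\},c\}=\{\{a,b\},\{c,d\}\}.$$
   Context: A third-type associative algebra is an associative (not necessarily unital) $K$-algebra satisfying the identity $abc+bac-bca-cba=0$; $\mathcal{A}s_3$ is the variety of all such algebras and $\mathcal{A}s_3\langle X\rangle$ is the free algebra of this variety generated by the set $X$. An identity of an algebra with one bilinear operation $\{\cdot,\cdot\}$ is an element $f$ of the free nonassociative (magmatic) algebra in that operation that vanishes under every substitution of elements of the algebra for the variables. An identity follows from given identities if it lies in the ideal of the free nonassociative algebra, closed under all substitutions (T-ideal), generated by them.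
   Formalization: The set X is assumed to have at least two elements: for |X|=1 the free algebra is xK[x], where {{a,b},c}={a,{b,c}} is a degree-3 identity that does not follow from the listed ones, and for X empty the algebra is 0. *)

theory Defs
  imports Complex_Main "HOL-Library.Poly_Mapping" "HOL.Hull"
begin

subsection \<open>The free nonassociative algebra\<close>

text \<open>The basis of the free nonassociative algebra on \<^typ>\<open>'v\<close> consists of the nonassociative words,
  i.e. binary trees with leaves in \<^typ>\<open>'v\<close>. The empty word is excluded: there is no unit.\<close>

datatype 'v magma = Leaf 'v | Node "'v magma" "'v magma"

type_synonym ('v, 'k) nonassoc = "'v magma \<Rightarrow>\<^sub>0 'k"

definition na_scale :: "'k::semiring_0 \<Rightarrow> ('v, 'k) nonassoc \<Rightarrow> ('v, 'k) nonassoc" where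
  "na_scale c f = Poly_Mapping.map ((*) c) f"

definition na_mult ::
    "('v, 'k::semiring_0) nonassoc \<Rightarrow> ('v, 'k) nonassoc \<Rightarrow> ('v, 'k) nonassoc"  (infixl \<open>\<star>\<close> 70) where
  "f \<star> g = (\<Sum>u\<in>Poly_Mapping.keys f. \<Sum>v\<in>Poly_Mapping.keys g.
     Poly_Mapping.single (Node u v) (Poly_Mapping.lookup f u * Poly_Mapping.lookup g v))"

definition na_var :: "'v \<Rightarrow> ('v, 'k::zero_neq_one) nonassoc" where
  "na_var x = Poly_Mapping.single (Leaf x) 1"

fun word_length :: "'v magma \<Rightarrow> nat" where
  "word_length (Leaf x) = 1"
| "word_length (Node u v) = word_length u + word_length v"

text \<open>The zero element satisfies this for every \<open>n\<close>.\<close>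

definition na_degree_le :: "('v, 'k::zero) nonassoc \<Rightarrow> nat \<Rightarrow> bool" where
  "na_degree_le f n \<longleftrightarrow> (\<forall>u\<in>Poly_Mapping.keys f. word_length u \<le> n)"

lemma lookup_na_scale [simp]:
  "Poly_Mapping.lookup (na_scale c f) u = c * Poly_Mapping.lookup f u"
  unfolding na_scale_def by (simp add: Poly_Mapping.map.rep_eq when_def)

interpretation na: vector_space "na_scale :: 'k::field \<Rightarrow> ('v, 'k) nonassoc \<Rightarrow> ('v, 'k) nonassoc"
  by unfold_locales (auto intro!: poly_mapping_eqI simp: lookup_add algebra_simps)

lemma na_mult_superset:
  assumes "finite A" "finite B" "Poly_Mapping.keys f \<subseteq> A" "Poly_Mapping.keys g \<subseteq> B"
  shows "f \<star> g = (\<Sum>u\<in>A. \<Sum>v\<in>B.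
     Poly_Mapping.single (Node u v) (Poly_Mapping.lookup f u * Poly_Mapping.lookup g v))"
proof -
  have "f \<star> g = (\<Sum>u\<in>Poly_Mapping.keys f. \<Sum>v\<in>B.
     Poly_Mapping.single (Node u v) (Poly_Mapping.lookup f u * Poly_Mapping.lookup g v))"
    unfolding na_mult_def using assms
    by (intro sum.cong sum.mono_neutral_left) (auto simp: in_keys_iff)
  also have "\<dots> = (\<Sum>u\<in>A. \<Sum>v\<in>B.
     Poly_Mapping.single (Node u v) (Poly_Mapping.lookup f u * Poly_Mapping.lookup g v))"
    using assms by (intro sum.mono_neutral_left) (auto simp: in_keys_iff)
  finally show ?thesis .
qed

lemma na_mult_add_left: "(f + g) \<star> h = f \<star> h + g \<star> h"
proof -
  let ?A = "Poly_Mapping.keys f \<union> Poly_Mapping.keys g" and ?B = "Poly_Mapping.keys h"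
  have "(f + g) \<star> h = (\<Sum>u\<in>?A. \<Sum>v\<in>?B. Poly_Mapping.single (Node u v)
      (Poly_Mapping.lookup (f + g) u * Poly_Mapping.lookup h v))"
    by (rule na_mult_superset) (use Poly_Mapping.keys_add[of f g] in auto)
  moreover have "f \<star> h = (\<Sum>u\<in>?A. \<Sum>v\<in>?B. Poly_Mapping.single (Node u v)
      (Poly_Mapping.lookup f u * Poly_Mapping.lookup h v))"
    by (rule na_mult_superset) auto
  moreover have "g \<star> h = (\<Sum>u\<in>?A. \<Sum>v\<in>?B. Poly_Mapping.single (Node u v)
      (Poly_Mapping.lookup g u * Poly_Mapping.lookup h v))"
    by (rule na_mult_superset) auto
  ultimately show ?thesis
    by (simp add: lookup_add distrib_right single_add sum.distrib)
qed

lemma na_mult_add_right: "f \<star> (g + h) = f \<star> g + f \<star> h"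
proof -
  let ?A = "Poly_Mapping.keys f" and ?B = "Poly_Mapping.keys g \<union> Poly_Mapping.keys h"
  have "f \<star> (g + h) = (\<Sum>u\<in>?A. \<Sum>v\<in>?B. Poly_Mapping.single (Node u v)
      (Poly_Mapping.lookup f u * Poly_Mapping.lookup (g + h) v))"
    by (rule na_mult_superset) (use Poly_Mapping.keys_add[of g h] in auto)
  moreover have "f \<star> g = (\<Sum>u\<in>?A. \<Sum>v\<in>?B. Poly_Mapping.single (Node u v)
      (Poly_Mapping.lookup f u * Poly_Mapping.lookup g v))"
    by (rule na_mult_superset) auto
  moreover have "f \<star> h = (\<Sum>u\<in>?A. \<Sum>v\<in>?B. Poly_Mapping.single (Node u v)
      (Poly_Mapping.lookup f u * Poly_Mapping.lookup h v))"
    by (rule na_mult_superset) auto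
  ultimately show ?thesis
    by (simp add: lookup_add distrib_left single_add sum.distrib)
qed

lemma na_mult_diff_left: "(f - g) \<star> h = f \<star> h - g \<star> h"
  for f g h :: "('v, 'k::ring) nonassoc"
  by (metis na_mult_add_left add_diff_cancel_right' diff_add_cancel)

lemma na_mult_diff_right: "f \<star> (g - h) = f \<star> g - f \<star> h"
  for f g h :: "('v, 'k::ring) nonassoc"
  by (metis na_mult_add_right add_diff_cancel_right' diff_add_cancel)

subsection \<open>Identities, ideals and T-ideals\<close>

primrec word_eval :: "('a \<Rightarrow> 'a \<Rightarrow> 'a) \<Rightarrow> ('v \<Rightarrow> 'a) \<Rightarrow> 'v magma \<Rightarrow> 'a" where
  "word_eval m \<sigma> (Leaf x) = \<sigma> x"
| "word_eval m \<sigma> (Node u v) = m (word_eval m \<sigma> u) (word_eval m \<sigma> v)"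

text \<open>The value of a nonassociative polynomial under the substitution \<open>\<sigma>\<close>, in the algebra with
  scalar multiplication \<open>s\<close> and bilinear operation \<open>m\<close>.\<close>

definition na_eval ::
    "('k::zero \<Rightarrow> 'a \<Rightarrow> 'a) \<Rightarrow> ('a \<Rightarrow> 'a \<Rightarrow> 'a) \<Rightarrow> ('v \<Rightarrow> 'a) \<Rightarrow> ('v, 'k) nonassoc \<Rightarrow> 'a::comm_monoid_add" where
  "na_eval s m \<sigma> f =
     (\<Sum>u\<in>Poly_Mapping.keys f. s (Poly_Mapping.lookup f u) (word_eval m \<sigma> u))"

text \<open>Identities live in the free nonassociative algebra on countably many variables.\<close>

definition is_identity ::
    "('k::zero \<Rightarrow> 'a::comm_monoid_add \<Rightarrow> 'a) \<Rightarrow> ('a \<Rightarrow> 'a \<Rightarrow> 'a) \<Rightarrow> (nat, 'k) nonassoc \<Rightarrow> bool" where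
  "is_identity s m f \<longleftrightarrow> (\<forall>\<sigma>. na_eval s m \<sigma> f = 0)"

definition na_ideal :: "('v, 'k::field) nonassoc set \<Rightarrow> bool" where
  "na_ideal I \<longleftrightarrow> na.subspace I \<and> (\<forall>f\<in>I. \<forall>g. f \<star> g \<in> I \<and> g \<star> f \<in> I)"

definition T_ideal :: "('v, 'k::field) nonassoc set \<Rightarrow> bool" where
  "T_ideal I \<longleftrightarrow> na_ideal I \<and> (\<forall>f\<in>I. \<forall>\<sigma>. na_eval na_scale (\<star>) \<sigma> f \<in> I)"

definition follows_from :: "('v, 'k::field) nonassoc \<Rightarrow> ('v, 'k) nonassoc set \<Rightarrow> bool" where
  "follows_from f S \<longleftrightarrow> f \<in> T_ideal hull S"

subsection \<open>The free third-type associative algebra\<close>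

text \<open>The free algebra of the variety is the quotient of the free nonassociative algebra on the
  generators by the ideal generated by all values of the defining identities of the variety:
  associativity and \<open>abc + bac - bca - cba = 0\<close>.\<close>

definition as3_ideal :: "('x, 'k::field) nonassoc set" where
  "as3_ideal = na_ideal hull
     ({(a \<star> b) \<star> c - a \<star> (b \<star> c) | a b c. True} \<union>
      {(a \<star> b) \<star> c + (b \<star> a) \<star> c - (b \<star> c) \<star> a - (c \<star> b) \<star> a | a b c. True})"

definition as3_rel :: "('x, 'k::field) nonassoc \<Rightarrow> ('x, 'k) nonassoc \<Rightarrow> bool" where
  "as3_rel f g \<longleftrightarrow> f - g \<in> as3_ideal"

lemma na_ideal_as3_ideal: "na_ideal as3_ideal"
  unfolding as3_ideal_def
  by (rule hull_in) (auto simp: na_ideal_def na.subspace_def)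

lemma as3_ideal_subspace: "na.subspace as3_ideal"
  and as3_ideal_mult_right: "f \<in> as3_ideal \<Longrightarrow> f \<star> g \<in> as3_ideal"
  and as3_ideal_mult_left: "f \<in> as3_ideal \<Longrightarrow> g \<star> f \<in> as3_ideal"
  using na_ideal_as3_ideal by (auto simp: na_ideal_def)

lemmas as3_ideal_add = na.subspace_add[OF as3_ideal_subspace]
lemmas as3_ideal_diff = na.subspace_diff[OF as3_ideal_subspace]
lemmas as3_ideal_neg = na.subspace_neg[OF as3_ideal_subspace]
lemmas as3_ideal_scale = na.subspace_scale[OF as3_ideal_subspace]
lemmas as3_ideal_0 = na.subspace_0[OF as3_ideal_subspace]

lemma as3_rel_refl: "as3_rel f f"
  by (simp add: as3_rel_def as3_ideal_0)

lemma equivp_as3_rel: "equivp as3_rel"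
proof (rule equivpI)
  show "reflp as3_rel"
    by (simp add: reflp_def as3_rel_refl)
  show "symp as3_rel"
    unfolding symp_def as3_rel_def by (metis as3_ideal_neg minus_diff_eq)
  show "transp as3_rel"
    unfolding transp_def as3_rel_def using as3_ideal_add by fastforce
qed

quotient_type (overloaded) ('x, 'k) as3 = "('x, 'k::field) nonassoc" / as3_rel
  by (rule equivp_as3_rel)

instantiation as3 :: (type, field) ring
begin

lift_definition zero_as3 :: "('a, 'b) as3" is 0 .

lift_definition plus_as3 :: "('a, 'b) as3 \<Rightarrow> ('a, 'b) as3 \<Rightarrow> ('a, 'b) as3" is "(+)"
  unfolding as3_rel_def by (metis add_diff_add as3_ideal_add)

lift_definition uminus_as3 :: "('a, 'b) as3 \<Rightarrow> ('a, 'b) as3" is uminus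
  unfolding as3_rel_def by (metis as3_ideal_neg minus_diff_minus)

lift_definition minus_as3 :: "('a, 'b) as3 \<Rightarrow> ('a, 'b) as3 \<Rightarrow> ('a, 'b) as3" is "(-)"
proof -
  fix f f' g g' :: "('a, 'b) nonassoc"
  assume "as3_rel f f'" "as3_rel g g'"
  moreover have "(f - g) - (f' - g') = (f - f') - (g - g')" by simp
  ultimately show "as3_rel (f - g) (f' - g')"
    unfolding as3_rel_def using as3_ideal_diff by metis
qed

lift_definition times_as3 :: "('a, 'b) as3 \<Rightarrow> ('a, 'b) as3 \<Rightarrow> ('a, 'b) as3" is "(\<star>)"
proof -
  fix f f' g g' :: "('a, 'b) nonassoc"
  assume "as3_rel f f'" "as3_rel g g'"
  moreover have "f \<star> g - f' \<star> g' = (f - f') \<star> g + f' \<star> (g - g')"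
    by (simp add: na_mult_diff_left na_mult_diff_right)
  ultimately show "as3_rel (f \<star> g) (f' \<star> g')"
    unfolding as3_rel_def
    using as3_ideal_add as3_ideal_mult_left as3_ideal_mult_right by metis
qed

instance
proof
  fix a b c :: "('a, 'b) as3"
  show "a * b * c = a * (b * c)"
    by transfer (auto simp: as3_rel_def as3_ideal_def intro!: hull_inc)
qed (transfer; simp add: as3_rel_refl na_mult_add_left na_mult_add_right ac_simps)+

end

lift_definition as3_scale :: "'k::field \<Rightarrow> ('x, 'k) as3 \<Rightarrow> ('x, 'k) as3" is na_scale
  unfolding as3_rel_def by (metis as3_ideal_scale na.scale_right_diff_distrib)

interpretation as3: vector_space "as3_scale :: 'k::field \<Rightarrow> ('x, 'k) as3 \<Rightarrow> ('x, 'k) as3"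
  by unfold_locales
    (transfer; simp add: as3_rel_refl na.scale_right_distrib na.scale_left_distrib)+

lemma as3_third_type: "a * b * c + b * a * c - b * c * a - c * b * a = 0"
  for a b c :: "('x, 'k::field) as3"
proof (transfer, unfold as3_rel_def as3_ideal_def, simp only: diff_zero, rule hull_inc, rule UnI2)
qed blast

definition anticomm :: "'a::ring \<Rightarrow> 'a \<Rightarrow> 'a" where
  "anticomm a b = a * b + b * a"

subsection \<open>The identities\<close>

definition as3_plus_identities :: "(nat, 'k::field) nonassoc set" where
  "as3_plus_identities =
    (let a = na_var 0; b = na_var 1; c = na_var 2; d = na_var 3 in
     {a \<star> b - b \<star> a,
      ((a \<star> b) \<star> c) \<star> d - ((a \<star> c) \<star> b) \<star> d,
      ((a \<star> b) \<star> c) \<star> d - ((a \<star> b) \<star> d) \<star> c,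
      ((a \<star> b) \<star> d) \<star> c - (a \<star> b) \<star> (c \<star> d)})"

end

theory Submission
  imports Defs "HOL-Library.Multiset" "HOL-Library.Product_Plus" "HOL-Computational_Algebra.Polynomial"
begin

text \<open>
  Write \<open>{a,b} = ab + ba\<close>. The defining identity reads \<open>{a,b}c = {b,c}a\<close>, so \<open>{a,b}c\<close> is symmetric in
  its three arguments. Inserting products for the arguments and dividing by \<open>2\<close>, one finds that a
  product of four elements of a third-type algebra does not depend on the order of the factors
  (\<open>as3_mult4_commute\<close>). An anticommutator monomial of degree \<open>4\<close> is therefore \<open>8abcd\<close>, whatever its
  bracketing, and the listed identities hold.

  Conversely, modulo commutativity and the identities of degree \<open>4\<close>, a nonassociative word of length
  at most \<open>4\<close> is determined by the multiset of its leaves together with, in length \<open>3\<close>, the leaf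
  \<open>k\<close> of \<open>{{i,j},k}\<close> that is multiplied last (\<open>word_class_determined\<close>). So \<open>f\<close> is a consequence of
  the identities as soon as its coefficients add up to zero over each class of words with the same
  such data (\<open>follows_from_class_sums_zero\<close>).

  That these sums vanish for an identity \<open>f\<close> is read off from two third-type algebras, which are
  images of the free one. Since the field is infinite, the words with a fixed multiset of leaves can
  be treated separately (\<open>multihomogeneous_component_zero\<close>). The field itself is a third-type
  algebra; sending each generator to \<open>1\<close> turns a word of length \<open>n\<close> into \<open>2^(n-1)\<close>, so
  the coefficients belonging to one multiset add up to zero (\<open>identity_coefficient_sum\<close>). It remains
  to separate the three classes in degree \<open>3\<close>. Here a six-dimensional nilpotent algebra on two generators
  \<open>a\<close>, \<open>b\<close> is used, in which \<open>{{p,q},r}\<close>, for \<open>p = a + y b\<close>, \<open>q = a + y' b\<close> and \<open>r = a + y'' b\<close>, is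
  \<open>y + y' - 2y''\<close> times a basis vector and so singles out \<open>r\<close> (\<open>identity_outer_leaf_relation\<close>); two
  generators are what makes these three elements available.
\<close>

section \<open>Products of four factors commute\<close>

lemma as3_double_cancel:
  fixes a b :: "('x, 'k::field_char_0) as3"
  assumes "a + a = b + b"
  shows "a = b"
proof -
  have double: "x + x = as3_scale 2 x" for x :: "('x, 'k) as3"
    using as3.scale_left_distrib[of 1 1 x] by simp
  from assms show ?thesis unfolding double by simp
qed

lemma double_eq_if_diff_eq:
  fixes y z w :: "'a::ab_group_add"
  assumes "y + w - z = z + w - y"
  shows "y + y = z + z"
proof -
  have "y + y = (y + w - z) + (y + z - w)" by simp
  also have "\<dots> = (z + w - y) + (y + z - w)" by (simp only: assms)
  finally show ?thesis by simp
qed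

text \<open>Together with the symmetry of the anticommutator, the third-type identity makes \<open>(ab + ba)c\<close> a
  symmetric function of its three arguments.\<close>

lemma as3_swap:
  fixes a b c :: "('x, 'k::field) as3"
  shows "(a * b + b * a) * c = (b * c + c * b) * a" "(a * b + b * a) * c = (a * c + c * a) * b"
  using as3_third_type[of a b c] as3_third_type[of b a c] by (simp_all add: algebra_simps)

text \<open>The element \<open>S a b c d\<close> is symmetric in \<open>a\<close>, \<open>b\<close>, \<open>c\<close>. Two evaluations of \<open>a{b,c}d\<close>, whose value
  is symmetric in \<open>b\<close>, \<open>c\<close>, \<open>d\<close>, show that the last argument may be exchanged as well. Then
  \<open>abcd + bacd\<close> and \<open>abcd + acbd\<close> equal the same \<open>S\<close>, hence \<open>abcd\<close> is invariant under rotating its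
  first three factors, and one more instance of the identity, with \<open>ab\<close> as an argument, gives
  \<open>abcd + cabd = S a b c d\<close>.\<close>

lemma as3_mult4_half:
  fixes a b c d :: "('x, 'k::field_char_0) as3"
  defines "S \<equiv> \<lambda>a b c d :: ('x, 'k) as3. (a * b + b * a) * c * d"
  shows "S a b c d = S a b d c" and "a * b * c * d + a * b * c * d = S a b c d"
proof -
  have S1: "S a b c d = S b a c d" for a b c d by (simp add: S_def add.commute)
  have S2: "S a b c d = S a c b d" for a b c d by (simp only: S_def as3_swap(2)[of a b c])
  \<comment> \<open>Regard \<open>bc\<close> as one argument and exchange it with \<open>d\<close>.\<close>
  have S_pair: "S a d b c = a * b * c * d + b * c * a * d" for a b c d
  proof -
    have "S a d b c = (a * d + d * a) * (b * c)" by (simp only: S_def mult.assoc)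
    also have "\<dots> = (a * (b * c) + (b * c) * a) * d" by (rule as3_swap(2))
    finally show ?thesis by (simp only: distrib_right mult.assoc)
  qed
  have inner: "a * (b * c + c * b) * d = S a d b c + S a d c b - S b c a d" for a b c d
  proof -
    have "S a d b c + S a d c b = a * (b * c + c * b) * d + S b c a d"
      unfolding S_pair[of a d b c] S_pair[of a d c b]
      by (simp only: S_def distrib_left distrib_right mult.assoc add_ac)
    then show ?thesis by simp
  qed
  have last: "S a b c d = S a b d c" for a b c d
  proof -
    have "a * (b * c + c * b) * d = a * (b * d + d * b) * c"
      by (simp add: as3_swap(2)[of b c d] mult.assoc)
    then have "S a d b c + S a d c b - S b c a d = S a c b d + S a c d b - S b d a c"
      unfolding inner .
    moreover have "S a d b c = S a b d c" "S b d a c = S a b d c" "S a c b d = S a b c d"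
      "S b c a d = S a b c d" "S a d c b = S a c d b"
      by (rule S2 trans[OF S2 S1])+
    ultimately have "S a b d c + S a c d b - S a b c d = S a b c d + S a c d b - S a b d c"
      by (simp only:)
    then have "S a b d c + S a b d c = S a b c d + S a b c d"
      by (rule double_eq_if_diff_eq)
    then have "S a b d c = S a b c d" by (rule as3_double_cancel)
    then show ?thesis by (rule sym)
  qed
  show "S a b c d = S a b d c" by (rule last)
  have mid: "a * (b * c + c * b) * d = S a b c d" for a b c d
  proof -
    have "S a d b c = S a b c d" by (rule trans[OF S2 last])
    moreover have "S a d c b = S b c a d"
    proof -
      have "S a d c b = S a c d b" by (rule S2)
      also have "\<dots> = S a c b d" by (rule last)
      also have "\<dots> = S a b c d" by (rule S2)
      also have "\<dots> = S b a c d" by (rule S1)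
      also have "\<dots> = S b c a d" by (rule S2)
      finally show ?thesis .
    qed
    ultimately show ?thesis by (simp only: inner add_diff_cancel_right')
  qed
  have rot: "a * b * c * d = c * a * b * d"
  proof -
    have "a * b * c * d + a * c * b * d = S a b c d"
      unfolding mid[symmetric] by (simp only: distrib_left distrib_right mult.assoc)
    moreover have "a * c * b * d + c * a * b * d = S a c b d"
      by (simp only: S_def distrib_right)
    ultimately have "a * b * c * d + a * c * b * d = a * c * b * d + c * a * b * d"
      using S2[of a b c d] by (simp only:)
    then have "a * c * b * d + a * b * c * d = a * c * b * d + c * a * b * d"
      by (subst add.commute)
    then show ?thesis by (rule add_left_imp_eq)
  qed
  have "a * b * c * d + c * a * b * d = S c d a b"
  proof -
    have "a * b * c * d + c * a * b * d = (a * b * c + c * (a * b)) * d"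
      by (simp only: distrib_right mult.assoc)
    also have "\<dots> = (c * d + d * c) * (a * b)" by (rule as3_swap(1))
    finally show ?thesis by (simp only: S_def mult.assoc)
  qed
  also have "\<dots> = S c a d b" by (rule S2)
  also have "\<dots> = S a c d b" by (rule S1)
  also have "\<dots> = S a c b d" by (rule last)
  also have "\<dots> = S a b c d" by (rule S2)
  finally show "a * b * c * d + a * b * c * d = S a b c d" unfolding rot[symmetric] .
qed

lemma as3_mult4_commute:
  fixes a b c d :: "('x, 'k::field_char_0) as3"
  shows "a * (b * (c * d)) = b * (a * (c * d))" "a * (b * (c * d)) = a * (c * (b * d))"
    "a * (b * (c * d)) = a * (b * (d * c))"
proof -
  note half = as3_mult4_half(2)
  have "(a * b + b * a) * c * d = (b * a + a * b) * c * d" by (simp only: add.commute)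
  then have "a * b * c * d = b * a * c * d"
    unfolding half[symmetric] by (rule as3_double_cancel)
  then show "a * (b * (c * d)) = b * (a * (c * d))" by (simp only: mult.assoc)
  have "(a * b + b * a) * c * d = (a * c + c * a) * b * d"
    by (simp only: as3_swap(2)[of a b c])
  then have "a * b * c * d = a * c * b * d"
    unfolding half[symmetric] by (rule as3_double_cancel)
  then show "a * (b * (c * d)) = a * (c * (b * d))" by (simp only: mult.assoc)
  have "a * b * c * d = a * b * d * c"
    using as3_mult4_half(1)[of a b c d] unfolding half[symmetric] by (rule as3_double_cancel)
  then show "a * (b * (c * d)) = a * (b * (d * c))" by (simp only: mult.assoc)
qed

section \<open>Evaluating nonassociative polynomials\<close>

locale nonassoc_algebra = vector_space scale
  for scale :: "'k::field \<Rightarrow> 'a::ab_group_add \<Rightarrow> 'a" (infixr "*s" 75) +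
  fixes mul :: "'a \<Rightarrow> 'a \<Rightarrow> 'a"
  assumes mul_add_left: "mul (a + b) c = mul a c + mul b c"
    and mul_add_right: "mul a (b + c) = mul a b + mul a c"
    and mul_scale_left: "mul (r *s a) b = r *s mul a b"
    and mul_scale_right: "mul a (r *s b) = r *s mul a b"
begin

abbreviation eval :: "('v \<Rightarrow> 'a) \<Rightarrow> ('v, 'k) nonassoc \<Rightarrow> 'a" where
  "eval \<equiv> na_eval scale mul"

lemma mul_sum_left: "mul (sum h A) b = (\<Sum>i\<in>A. mul (h i) b)"
proof -
  interpret additive "\<lambda>a. mul a b" by unfold_locales (rule mul_add_left)
  show ?thesis by (rule sum)
qed

lemma mul_sum_right: "mul a (sum h A) = (\<Sum>i\<in>A. mul a (h i))"
proof -
  interpret additive "mul a" by unfold_locales (rule mul_add_right)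
  show ?thesis by (rule sum)
qed

lemma eval_superset:
  assumes "finite U" "Poly_Mapping.keys f \<subseteq> U"
  shows "eval \<tau> f = (\<Sum>u\<in>U. Poly_Mapping.lookup f u *s word_eval mul \<tau> u)"
  unfolding na_eval_def using assms
  by (intro sum.mono_neutral_left) (auto simp: in_keys_iff)

lemma eval_add: "eval \<tau> (f + g) = eval \<tau> f + eval \<tau> g"
proof -
  let ?U = "Poly_Mapping.keys f \<union> Poly_Mapping.keys g"
  have "Poly_Mapping.keys (f + g) \<subseteq> ?U" by (rule keys_add)
  then show ?thesis
    by (simp add: eval_superset[of ?U] lookup_add scale_left_distrib sum.distrib)
qed

lemma eval_scale: "eval \<tau> (na_scale c f) = c *s eval \<tau> f"
proof -
  have "Poly_Mapping.keys (na_scale c f) \<subseteq> Poly_Mapping.keys f"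
    by (auto simp: in_keys_iff)
  then show ?thesis
    by (simp add: eval_superset[of "Poly_Mapping.keys f"] scale_sum_right)
qed

lemma eval_zero: "eval \<tau> 0 = 0"
  by (simp add: na_eval_def)

lemma eval_diff: "eval \<tau> (f - g) = eval \<tau> f - eval \<tau> g"
  by (metis eval_add add_diff_cancel_right' diff_add_cancel)

lemma eval_sum: "eval \<tau> (sum h A) = (\<Sum>i\<in>A. eval \<tau> (h i))"
proof -
  interpret additive "eval \<tau>" by unfold_locales (rule eval_add)
  show ?thesis by (rule sum)
qed

lemma eval_single: "eval \<tau> (Poly_Mapping.single u c) = c *s word_eval mul \<tau> u"
  by (simp add: eval_superset[of "{u}"])

lemma eval_var: "eval \<tau> (na_var x) = \<tau> x"
  by (simp add: na_var_def eval_single)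

lemma eval_mult: "eval \<tau> (f \<star> g) = mul (eval \<tau> f) (eval \<tau> g)"
proof -
  have "eval \<tau> (f \<star> g) = (\<Sum>u\<in>Poly_Mapping.keys f. \<Sum>v\<in>Poly_Mapping.keys g.
      (Poly_Mapping.lookup f u * Poly_Mapping.lookup g v) *s
        mul (word_eval mul \<tau> u) (word_eval mul \<tau> v))"
    by (simp add: na_mult_def eval_sum eval_single)
  also have "\<dots> = (\<Sum>u\<in>Poly_Mapping.keys f.
      Poly_Mapping.lookup f u *s mul (word_eval mul \<tau> u) (eval \<tau> g))"
    by (simp add: na_eval_def mul_sum_right mul_scale_right scale_sum_right)
  also have "\<dots> = mul (eval \<tau> f) (eval \<tau> g)"
    by (simp add: na_eval_def[of _ _ _ f] mul_sum_left mul_scale_left)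
  finally show ?thesis .
qed

lemmas eval_simps = eval_add eval_diff eval_mult eval_var

end

text \<open>Substitution into a nonassociative polynomial is evaluation in the free nonassociative algebra.\<close>

interpretation nonassoc: nonassoc_algebra
  "na_scale :: 'k::field \<Rightarrow> ('v, 'k) nonassoc \<Rightarrow> ('v, 'k) nonassoc" "(\<star>)"
proof
  fix r :: 'k and a b :: "('v, 'k) nonassoc"
  have *: "Poly_Mapping.keys (na_scale r f) \<subseteq> Poly_Mapping.keys f" for f :: "('v, 'k) nonassoc"
    by (auto simp: in_keys_iff)
  have **: "na_scale r (sum h A) = (\<Sum>i\<in>A. na_scale r (h i))"
    for h :: "'v magma \<Rightarrow> ('v, 'k) nonassoc" and A
    by (rule na.scale_sum_right)
  have [simp]: "na_scale r (Poly_Mapping.single u c) = Poly_Mapping.single u (r * c)"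
    for u :: "'v magma" and c
    by (rule poly_mapping_eqI) (simp add: lookup_single when_def)
  show "na_scale r a \<star> b = na_scale r (a \<star> b)"
    by (subst na_mult_superset[OF finite_keys finite_keys * order_refl])
      (simp add: na_mult_def ** mult.assoc)
  show "a \<star> na_scale r b = na_scale r (a \<star> b)"
    by (subst na_mult_superset[OF finite_keys finite_keys order_refl *])
      (simp add: na_mult_def ** mult.left_commute)
qed (rule na_mult_add_left na_mult_add_right)+

lemma as3_scale_mult:
  fixes a b :: "('x, 'k::field) as3"
  shows "as3_scale r a * b = as3_scale r (a * b)" "a * as3_scale r b = as3_scale r (a * b)"
  by (transfer, simp add: as3_rel_refl nonassoc.mul_scale_left nonassoc.mul_scale_right)+

interpretation as3_plus: nonassoc_algebra
  "as3_scale :: 'k::field \<Rightarrow> ('x, 'k) as3 \<Rightarrow> ('x, 'k) as3" anticomm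
  by unfold_locales
    (simp_all add: anticomm_def as3_scale_mult as3.scale_right_distrib algebra_simps)

lemma as3_plus_identities_cases:
  assumes "f \<in> as3_plus_identities"
  obtains "f = na_var 0 \<star> na_var 1 - na_var 1 \<star> na_var 0"
  | "f = ((na_var 0 \<star> na_var 1) \<star> na_var 2) \<star> na_var 3 - ((na_var 0 \<star> na_var 2) \<star> na_var 1) \<star> na_var 3"
  | "f = ((na_var 0 \<star> na_var 1) \<star> na_var 2) \<star> na_var 3 - ((na_var 0 \<star> na_var 1) \<star> na_var 3) \<star> na_var 2"
  | "f = ((na_var 0 \<star> na_var 1) \<star> na_var 3) \<star> na_var 2 - (na_var 0 \<star> na_var 1) \<star> (na_var 2 \<star> na_var 3)"
  using assms unfolding as3_plus_identities_def Let_def by blast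

lemma anticomm_degree4:
  fixes a b c d :: "('x, 'k::field_char_0) as3"
  defines "p \<equiv> a * (b * (c * d))"
  shows "anticomm (anticomm (anticomm a b) c) d = p + p + p + p + p + p + p + p"
    and "anticomm (anticomm a b) (anticomm c d) = p + p + p + p + p + p + p + p"
  unfolding p_def anticomm_def distrib_left distrib_right mult.assoc
  by (simp_all only: as3_mult4_commute add.assoc)

text \<open>Both sides of each identity of degree \<open>4\<close> are eight times the same commutative product.\<close>

lemma as3_plus_satisfies:
  fixes f :: "(nat, 'k::field_char_0) nonassoc"
  assumes "f \<in> as3_plus_identities"
  shows "is_identity as3_scale (anticomm :: ('x, 'k) as3 \<Rightarrow> _) f"
proof -
  have "na_eval as3_scale (anticomm :: ('x, 'k) as3 \<Rightarrow> _) \<sigma> f = 0" for \<sigma>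
  proof -
    let ?p = "\<sigma> 0 * (\<sigma> 1 * (\<sigma> 2 * \<sigma> 3)) :: ('x, 'k) as3"
    have "\<sigma> 0 * (\<sigma> 2 * (\<sigma> 1 * \<sigma> 3)) = ?p" "\<sigma> 0 * (\<sigma> 1 * (\<sigma> 3 * \<sigma> 2)) = ?p"
      by (rule as3_mult4_commute)+
    then show ?thesis
      using assms
    proof (elim as3_plus_identities_cases)
      assume "f = na_var 0 \<star> na_var 1 - na_var 1 \<star> na_var 0"
      then show ?thesis by (simp add: as3_plus.eval_simps anticomm_def add.commute)
    qed (simp_all only: as3_plus.eval_simps anticomm_degree4 diff_self)
  qed
  then show ?thesis by (simp add: is_identity_def)
qed

section \<open>Homomorphisms out of the free third-type algebra\<close>

text \<open>Images of the free third-type algebra are easier to compute in than the algebra itself; what holds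
  in the free algebra is transported to them by the homomorphism \<open>as3_lift\<close> below.\<close>

locale third_type_algebra = nonassoc_algebra +
  assumes mul_assoc: "mul (mul a b) c = mul a (mul b c)"
    and third_type:
      "mul (mul a b) c + mul (mul b a) c - mul (mul b c) a - mul (mul c b) a = 0"
begin

text \<open>The kernel of an evaluation is an ideal, and it contains the relations that generate
  \<open>as3_ideal\<close>.\<close>

lemma eval_as3_ideal:
  assumes "f \<in> as3_ideal"
  shows "eval g f = 0"
proof -
  let ?R = "{(a \<star> b) \<star> c - a \<star> (b \<star> c) | a b c. True} \<union>
    {(a \<star> b) \<star> c + (b \<star> a) \<star> c - (b \<star> c) \<star> a - (c \<star> b) \<star> a | a b c. True}"
  have mul_zero: "mul 0 b = 0" "mul b 0 = 0" for b
    using mul_add_left[of 0 0 b] mul_add_right[of b 0 0] by auto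
  have "na_ideal {f. eval g f = 0}"
    by (simp add: na_ideal_def na.subspace_def eval_zero eval_add eval_scale eval_mult mul_zero)
  moreover have "?R \<subseteq> {f. eval g f = 0}"
  proof (intro subsetI CollectI, elim UnE CollectE exE conjE)
    fix f a b c :: "('c, 'a) nonassoc"
    show "eval g f = 0" if "f = (a \<star> b) \<star> c - a \<star> (b \<star> c)"
      unfolding that by (simp add: eval_simps mul_assoc)
    show "eval g f = 0" if "f = (a \<star> b) \<star> c + (b \<star> a) \<star> c - (b \<star> c) \<star> a - (c \<star> b) \<star> a"
      unfolding that eval_simps by (rule third_type)
  qed
  ultimately have "na_ideal hull ?R \<subseteq> {f. eval g f = 0}" by (intro hull_minimal)
  then show ?thesis using assms by (auto simp: as3_ideal_def)
qed

definition as3_lift :: "('x \<Rightarrow> 'b) \<Rightarrow> ('x, 'a) as3 \<Rightarrow> 'b" where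
  "as3_lift g a = eval g (rep_as3 a)"

lemma as3_lift_abs: "as3_lift g (abs_as3 f) = eval g f"
proof -
  have "as3_rel (rep_as3 (abs_as3 f)) f"
    by (rule Quotient3_rep_abs[OF Quotient3_as3 as3_rel_refl])
  then have "eval g (rep_as3 (abs_as3 f) - f) = 0"
    unfolding as3_rel_def by (rule eval_as3_ideal)
  then show ?thesis by (simp add: as3_lift_def eval_diff)
qed

lemma as3_lift_add: "as3_lift g (a + b) = as3_lift g a + as3_lift g b"
  by (induction a, induction b) (simp add: plus_as3.abs_eq as3_lift_abs eval_add)

lemma as3_lift_mult: "as3_lift g (a * b) = mul (as3_lift g a) (as3_lift g b)"
  by (induction a, induction b) (simp add: times_as3.abs_eq as3_lift_abs eval_mult)

lemma as3_lift_scale: "as3_lift g (as3_scale r a) = r *s as3_lift g a"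
  by (induction a) (simp add: as3_scale.abs_eq as3_lift_abs eval_scale)

lemma as3_lift_var: "as3_lift g (abs_as3 (na_var x)) = g x"
  by (simp add: as3_lift_abs eval_var)

lemma as3_lift_word_eval:
  "as3_lift g (word_eval anticomm \<sigma> u) =
    word_eval (\<lambda>a b. mul a b + mul b a) (\<lambda>i. as3_lift g (\<sigma> i)) u"
  by (induction u) (simp_all add: anticomm_def as3_lift_add as3_lift_mult)

end

section \<open>Words of length at most four\<close>

primrec leaves :: "'v magma \<Rightarrow> 'v multiset" where
  "leaves (Leaf x) = {#x#}"
| "leaves (Node u v) = leaves u + leaves v"

lemma size_leaves: "size (leaves u) = word_length u"
  by (induction u) auto

lemma word_length_pos: "word_length u > 0"
  by (induction u) auto

text \<open>Commutativity alone leaves three classes of words of length \<open>3\<close> in given distinct letters; they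
  are told apart by the leaf that hangs directly off the root.\<close>

fun outer_leaf :: "'v magma \<Rightarrow> 'v option" where
  "outer_leaf (Node (Node (Leaf i) (Leaf j)) (Leaf k)) = Some k"
| "outer_leaf (Node (Leaf k) (Node (Leaf i) (Leaf j))) = Some k"
| "outer_leaf _ = None"

lemma word_length_eq_1: "word_length u = 1 \<longleftrightarrow> (\<exists>i. u = Leaf i)"
proof (cases u)
  case (Node v w)
  then show ?thesis using word_length_pos[of v] word_length_pos[of w] by simp
qed simp

lemma word_length_eq_2: "word_length u = 2 \<longleftrightarrow> (\<exists>i j. u = Node (Leaf i) (Leaf j))"
proof (cases u)
  case (Node v w)
  have "word_length u = 2 \<longleftrightarrow> word_length v = 1 \<and> word_length w = 1"
    using Node word_length_pos[of v] word_length_pos[of w] by auto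
  then show ?thesis using Node by (auto simp only: word_length_eq_1 magma.inject)
qed simp

lemma word_length_eq_3:
  "word_length u = 3 \<longleftrightarrow>
    (\<exists>i j k. u = Node (Node (Leaf i) (Leaf j)) (Leaf k) \<or> u = Node (Leaf k) (Node (Leaf i) (Leaf j)))"
proof (cases u)
  case (Node v w)
  have "word_length u = 3 \<longleftrightarrow>
      word_length v = 2 \<and> word_length w = 1 \<or> word_length v = 1 \<and> word_length w = 2"
    using Node word_length_pos[of v] word_length_pos[of w] by auto
  then show ?thesis
    unfolding word_length_eq_1 word_length_eq_2 using Node by blast
qed simp

lemma word_length_eq_4_cases:
  assumes "word_length u = 4"
  obtains (two_two) a b c d where "u = Node (Node (Leaf a) (Leaf b)) (Node (Leaf c) (Leaf d))"
  | (three_one) v d where "u = Node v (Leaf d)" "word_length v = 3"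
  | (one_three) v d where "u = Node (Leaf d) v" "word_length v = 3"
proof (cases u)
  case (Node v w)
  have "word_length v = 2 \<and> word_length w = 2 \<or> word_length v = 3 \<and> word_length w = 1
      \<or> word_length v = 1 \<and> word_length w = 3"
    using assms Node word_length_pos[of v] word_length_pos[of w] by auto
  then show ?thesis
    unfolding word_length_eq_1 word_length_eq_2 using Node that by blast
qed (use assms in simp)

lemma outer_leaf_None_iff: "outer_leaf u = None \<longleftrightarrow> word_length u \<noteq> 3"
  unfolding word_length_eq_3 by (cases u rule: outer_leaf.cases) auto

section \<open>Multihomogeneous components of an identity\<close>

text \<open>A polynomial that vanishes on an infinite field has zero coefficients.\<close>

lemma power_sum_coefficients_zero:
  fixes a :: "'i \<Rightarrow> 'k::field_char_0"
  assumes "finite U" and "\<And>z. (\<Sum>u\<in>U. a u * z ^ n u) = 0"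
  shows "(\<Sum>u\<in>{u\<in>U. n u = j}. a u) = 0"
proof -
  let ?p = "\<Sum>u\<in>U. monom (a u) (n u)"
  have "poly ?p z = 0" for z
    using assms(2)[of z] by (simp add: poly_sum poly_monom)
  then have "?p = 0" using poly_all_0_iff_0 by blast
  then have "coeff ?p j = 0" by simp
  then have "(\<Sum>u\<in>U. if n u = j then a u else 0) = 0"
    by (simp add: coeff_sum)
  then show ?thesis using assms(1) by (simp add: sum.inter_filter)
qed

lemma (in nonassoc_algebra) word_eval_scale_var:
  "word_eval mul (\<tau>(x := z *s \<tau> x)) u = z ^ count (leaves u) x *s word_eval mul \<tau> u"
  by (induction u)
    (auto simp: mul_scale_left mul_scale_right power_add mult.commute)


text \<open>Scaling the substituted element of one variable \<open>x\<close> by \<open>z\<close> multiplies each word by a power of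
  \<open>z\<close>, which separates the words according to their degree in \<open>x\<close>. The resulting sums again vanish
  under every substitution, so the variables in \<open>V\<close> can be treated one after the other. The linear
  functional \<open>l\<close> reduces the statement to polynomials over the field.\<close>

lemma multihomogeneous_sum_zero:
  fixes c :: "'v magma \<Rightarrow> 'k::field_char_0" and l :: "'a::ab_group_add \<Rightarrow> 'k"
  assumes "nonassoc_algebra scale mul"
    and scale: "\<And>r a. l (scale r a) = r * l a"
    and "finite U" "finite V"
    and zero: "\<And>\<tau>. (\<Sum>u\<in>U. c u * l (word_eval mul \<tau> u)) = 0"
  shows "(\<Sum>u\<in>{u\<in>U. \<forall>x\<in>V. count (leaves u) x = N x}. c u * l (word_eval mul \<tau> u)) = 0"
  using \<open>finite V\<close>
proof (induction V arbitrary: \<tau>)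
  case empty
  then show ?case using zero by simp
next
  case (insert x V)
  interpret nonassoc_algebra scale mul by fact
  let ?W = "{u\<in>U. \<forall>x\<in>V. count (leaves u) x = N x}"
  have "(\<Sum>u\<in>?W. c u * l (word_eval mul \<tau> u) * z ^ count (leaves u) x) = 0" for z
    using insert.IH[of "\<tau>(x := scale z (\<tau> x))"]
    by (simp only: word_eval_scale_var scale mult_ac)
  then have "(\<Sum>u\<in>{u\<in>?W. count (leaves u) x = N x}. c u * l (word_eval mul \<tau> u)) = 0"
    using \<open>finite U\<close> by (intro power_sum_coefficients_zero) auto
  moreover have "{u\<in>?W. count (leaves u) x = N x}
      = {u\<in>U. \<forall>x\<in>insert x V. count (leaves u) x = N x}"
    by auto
  ultimately show ?case by simp
qed

lemma multihomogeneous_component_zero: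
  fixes f :: "(nat, 'k::field_char_0) nonassoc" and l :: "'a::ab_group_add \<Rightarrow> 'k"
  assumes alg: "nonassoc_algebra scale mul"
    and add: "\<And>a b. l (a + b) = l a + l b"
    and scale: "\<And>r a. l (scale r a) = r * l a"
    and id: "is_identity scale mul f"
  shows "(\<Sum>u\<in>{u\<in>Poly_Mapping.keys f. leaves u = M}.
    Poly_Mapping.lookup f u * l (word_eval mul \<tau> u)) = 0"
proof -
  interpret l: additive l by unfold_locales (rule add)
  let ?K = "Poly_Mapping.keys f"
  let ?V = "set_mset M \<union> (\<Union>u\<in>?K. set_mset (leaves u))"
  have "(\<Sum>u\<in>?K. Poly_Mapping.lookup f u * l (word_eval mul \<tau> u)) = l (na_eval scale mul \<tau> f)"
    for \<tau> by (simp add: na_eval_def l.sum scale)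
  then have "(\<Sum>u\<in>?K. Poly_Mapping.lookup f u * l (word_eval mul \<tau> u)) = 0" for \<tau>
    using id by (simp add: is_identity_def l.zero)
  then have "(\<Sum>u\<in>{u\<in>?K. \<forall>x\<in>?V. count (leaves u) x = count M x}.
      Poly_Mapping.lookup f u * l (word_eval mul \<tau> u)) = 0"
    by (intro multihomogeneous_sum_zero[OF alg scale]) auto
  moreover have "leaves u = M \<longleftrightarrow> (\<forall>x\<in>?V. count (leaves u) x = count M x)"
    if u: "u \<in> ?K" for u
  proof (intro iffI multiset_eqI)
    fix x
    assume eq: "\<forall>x\<in>?V. count (leaves u) x = count M x"
    show "count (leaves u) x = count M x"
    proof (cases "x \<in> ?V")
      case False
      then have "x \<notin># leaves u" "x \<notin># M" using u by auto
      then show ?thesis by (simp add: not_in_iff)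
    qed (use eq in blast)
  qed simp
  then have "{u\<in>?K. leaves u = M} = {u\<in>?K. \<forall>x\<in>?V. count (leaves u) x = count M x}" by blast
  ultimately show ?thesis by simp
qed

section \<open>Two algebras of third type that detect the coefficients\<close>

lemma third_type_algebra_field: "third_type_algebra ((*) :: 'k::field \<Rightarrow> 'k \<Rightarrow> 'k) (*)"
  by unfold_locales (simp_all add: algebra_simps)

text \<open>Every commutative associative algebra is of third type. In the field, with all variables set to
  \<open>1\<close>, a word of length \<open>n\<close> takes the value \<open>2^(n-1)\<close>; the factor \<open>2\<close> in the proof avoids the
  subtraction.\<close>

lemma identity_coefficient_sum:
  fixes f :: "(nat, 'k::field_char_0) nonassoc"
  assumes "is_identity as3_scale (anticomm :: ('x, 'k) as3 \<Rightarrow> _) f"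
  shows "(\<Sum>u\<in>{u\<in>Poly_Mapping.keys f. leaves u = M}. Poly_Mapping.lookup f u) = 0"
proof -
  interpret field_algebra: third_type_algebra "(*) :: 'k \<Rightarrow> 'k \<Rightarrow> 'k" "(*)"
    by (rule third_type_algebra_field)
  let ?l = "field_algebra.as3_lift (\<lambda>_. 1) :: ('x, 'k) as3 \<Rightarrow> 'k"
  let ?\<tau> = "\<lambda>_. abs_as3 (na_var undefined) :: ('x, 'k) as3"
  let ?U = "{u\<in>Poly_Mapping.keys f. leaves u = M}"
  have power: "2 * ?l (word_eval anticomm ?\<tau> u) = 2 ^ size (leaves u)" for u :: "nat magma"
    unfolding field_algebra.as3_lift_word_eval field_algebra.as3_lift_var
    by (induction u) (simp_all add: power_add flip: mult_2)
  have "(\<Sum>u\<in>?U. Poly_Mapping.lookup f u * ?l (word_eval anticomm ?\<tau> u)) = 0"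
    by (intro multihomogeneous_component_zero[OF as3_plus.nonassoc_algebra_axioms]
        field_algebra.as3_lift_add field_algebra.as3_lift_scale assms)
  then have "0 = 2 * (\<Sum>u\<in>?U. Poly_Mapping.lookup f u * ?l (word_eval anticomm ?\<tau> u))"
    by simp
  also have "\<dots> = (\<Sum>u\<in>?U. Poly_Mapping.lookup f u * 2 ^ size (leaves u))"
    by (simp only: sum_distrib_left mult.left_commute[of 2] power)
  also have "\<dots> = (\<Sum>u\<in>?U. Poly_Mapping.lookup f u * 2 ^ size M)"
    by (rule sum.cong) auto
  also have "\<dots> = (\<Sum>u\<in>?U. Poly_Mapping.lookup f u) * 2 ^ size M"
    by (simp only: sum_distrib_right)
  finally show ?thesis by simp
qed

text \<open>
  Let \<open>V\<close> be the plane with coordinates \<open>p1\<close>, \<open>p2\<close>. A trilinear product on \<open>V\<close> that is antisymmetric in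
  its first two arguments satisfies the third-type identity, because all of its terms \<open>{a,b}c\<close> vanish;
  take \<open>pqr = (p1 q2 - p2 q1) r1\<close>. Then \<open>{{p,q},r} = r{p,q}\<close> still depends on which argument is \<open>r\<close>.

  The algebra has degrees \<open>1\<close>, \<open>2\<close>, \<open>3\<close>: the entries of a tuple are the two coordinates of degree \<open>1\<close>,
  the coordinates \<open>q11\<close>, \<open>q21\<close>, \<open>q12\<close> of the degree \<open>2\<close> part (the entries of a tensor in \<open>V \<otimes> V\<close>
  other than the \<open>22\<close> entry, on which triple products do not depend), and the coordinate \<open>t\<close> of
  degree \<open>3\<close>. All products of degree \<open>4\<close> are zero.
\<close>

type_synonym 'k nil4 = "'k \<times> 'k \<times> 'k \<times> 'k \<times> 'k \<times> 'k"

fun nil4_scale :: "'k::field \<Rightarrow> 'k nil4 \<Rightarrow> 'k nil4" where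
  "nil4_scale r (p1, p2, q11, q21, q12, t) = (r * p1, r * p2, r * q11, r * q21, r * q12, r * t)"

fun nil4_mult :: "'k::field nil4 \<Rightarrow> 'k nil4 \<Rightarrow> 'k nil4" where
  "nil4_mult (p1, p2, q11, q21, q12, t) (p1', p2', q11', q21', q12', t') =
    (0, 0, p1 * p1', p2 * p1', p1 * p2', p1 * q21' - p2 * q11' + (q12 - q21) * p1')"

fun nil4_top :: "'k nil4 \<Rightarrow> 'k" where
  "nil4_top (p1, p2, q11, q21, q12, t) = t"

interpretation nil4: third_type_algebra "nil4_scale :: 'k::field \<Rightarrow> _" nil4_mult
proof
  fix r r' :: 'k and a b c :: "'k nil4"
  show "nil4_scale r (a + b) = nil4_scale r a + nil4_scale r b"
    by (cases a rule: prod_cases6; cases b rule: prod_cases6) (simp add: algebra_simps)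
  show "nil4_scale (r + r') a = nil4_scale r a + nil4_scale r' a"
    by (cases a rule: prod_cases6) (simp add: algebra_simps)
  show "nil4_scale r (nil4_scale r' a) = nil4_scale (r * r') a"
    by (cases a rule: prod_cases6) (simp add: algebra_simps)
  show "nil4_scale 1 a = a"
    by (cases a rule: prod_cases6) simp
  show "nil4_mult (a + b) c = nil4_mult a c + nil4_mult b c"
    "nil4_mult c (a + b) = nil4_mult c a + nil4_mult c b"
    by (cases a rule: prod_cases6; cases b rule: prod_cases6; cases c rule: prod_cases6;
        simp add: algebra_simps)+
  show "nil4_mult (nil4_scale r a) b = nil4_scale r (nil4_mult a b)"
    "nil4_mult a (nil4_scale r b) = nil4_scale r (nil4_mult a b)"
    by (cases a rule: prod_cases6; cases b rule: prod_cases6; simp add: algebra_simps)+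
  show "nil4_mult (nil4_mult a b) c = nil4_mult a (nil4_mult b c)"
    by (cases a rule: prod_cases6; cases b rule: prod_cases6; cases c rule: prod_cases6)
      (simp add: algebra_simps)
  show "nil4_mult (nil4_mult a b) c + nil4_mult (nil4_mult b a) c
      - nil4_mult (nil4_mult b c) a - nil4_mult (nil4_mult c b) a = 0"
    by (cases a rule: prod_cases6; cases b rule: prod_cases6; cases c rule: prod_cases6)
      (simp add: algebra_simps)
qed

definition nil4_plus :: "'k::field nil4 \<Rightarrow> 'k nil4 \<Rightarrow> 'k nil4" where
  "nil4_plus a b = nil4_mult a b + nil4_mult b a"

lemma nil4_plus_degree4:
  "nil4_top (nil4_plus (nil4_plus a b) (nil4_plus c d)) = 0"
  "nil4_top (nil4_plus (nil4_plus (nil4_plus a b) c) d) = 0"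
  "nil4_top (nil4_plus (nil4_plus c (nil4_plus a b)) d) = 0"
  "nil4_top (nil4_plus d (nil4_plus (nil4_plus a b) c)) = 0"
  "nil4_top (nil4_plus d (nil4_plus c (nil4_plus a b))) = 0"
  by (cases a rule: prod_cases6; cases b rule: prod_cases6; cases c rule: prod_cases6;
      cases d rule: prod_cases6; simp add: nil4_plus_def)+

text \<open>In degree \<open>3\<close>, with outer leaf \<open>k\<close> and the other leaves \<open>i\<close>, \<open>j\<close>, the value is
  \<open>y i + y j - 2 y k\<close>. It is written as the sum over all leaves minus \<open>3 y k\<close>, so that only the
  second term depends on more than the multiset of leaves.\<close>

lemma nil4_plus_word_top:
  "nil4_top (word_eval nil4_plus (\<lambda>i. (1, y i, 0, 0, 0, 0)) u) =
    (case outer_leaf u of None \<Rightarrow> 0 | Some k \<Rightarrow> (\<Sum>i\<in>#leaves u. y i) - 3 * y k)"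
proof (cases u rule: outer_leaf.cases)
qed (simp_all add: nil4_plus_degree4, simp_all add: nil4_plus_def algebra_simps)

lemma nil4_top_add: "nil4_top (a + b) = nil4_top a + nil4_top b"
  by (cases a rule: prod_cases6; cases b rule: prod_cases6; simp)

lemma nil4_top_scale: "nil4_top (nil4_scale r a) = r * nil4_top a"
  by (cases a rule: prod_cases6) simp

text \<open>The substitution sends the variable \<open>i\<close> to \<open>x + y i \<cdot> x'\<close>, where \<open>x\<close> and \<open>x'\<close> are two free
  generators.\<close>

lemma identity_outer_leaf_relation:
  fixes f :: "(nat, 'k::field_char_0) nonassoc" and y :: "nat \<Rightarrow> 'k" and x x' :: 'x
  assumes "is_identity as3_scale (anticomm :: ('x, 'k) as3 \<Rightarrow> _) f" and "x \<noteq> x'"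
  shows "(\<Sum>u\<in>{u\<in>Poly_Mapping.keys f. leaves u = M}. Poly_Mapping.lookup f u *
    (case outer_leaf u of None \<Rightarrow> 0 | Some k \<Rightarrow> (\<Sum>i\<in>#leaves u. y i) - 3 * y k)) = 0"
proof -
  let ?g = "\<lambda>z. if z = x then (1, 0, 0, 0, 0, 0) else (0, 1, 0, 0, 0, 0) :: 'k nil4"
  let ?l = "nil4.as3_lift ?g :: ('x, 'k) as3 \<Rightarrow> 'k nil4"
  let ?\<tau> = "\<lambda>i. abs_as3 (na_var x) + as3_scale (y i) (abs_as3 (na_var x')) :: ('x, 'k) as3"
  have gen: "?l (?\<tau> i) = (1, y i, 0, 0, 0, 0)" for i
    using assms(2) by (simp add: nil4.as3_lift_add nil4.as3_lift_scale nil4.as3_lift_var)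
  have "(\<Sum>u\<in>{u\<in>Poly_Mapping.keys f. leaves u = M}.
      Poly_Mapping.lookup f u * nil4_top (?l (word_eval anticomm ?\<tau> u))) = 0"
    by (rule multihomogeneous_component_zero[OF as3_plus.nonassoc_algebra_axioms])
      (simp_all add: nil4.as3_lift_add nil4.as3_lift_scale nil4_top_add nil4_top_scale assms(1))
  moreover have "?l (word_eval anticomm ?\<tau> u) =
      word_eval nil4_plus (\<lambda>i. (1, y i, 0, 0, 0, 0)) u" for u :: "nat magma"
    unfolding nil4.as3_lift_word_eval gen nil4_plus_def[abs_def] ..
  ultimately show ?thesis by (simp only: nil4_plus_word_top)
qed

text \<open>In degree \<open>3\<close>, take \<open>y\<close> to be the indicator of a variable \<open>m\<close>. For a fixed multiset of leaves the
  first term of the previous relation is a multiple of the sum of all coefficients, which is zero, so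
  three times the sum over the words with outer leaf \<open>m\<close> vanishes. In the other degrees there
  is only one class per multiset.\<close>

lemma identity_class_sum_zero:
  fixes f :: "(nat, 'k::field_char_0) nonassoc" and x x' :: 'x
  assumes id: "is_identity as3_scale (anticomm :: ('x, 'k) as3 \<Rightarrow> _) f" and "x \<noteq> x'"
  shows "(\<Sum>u\<in>{u\<in>Poly_Mapping.keys f. leaves u = M \<and> outer_leaf u = p}. Poly_Mapping.lookup f u) = 0"
proof -
  let ?K = "Poly_Mapping.keys f" and ?c = "Poly_Mapping.lookup f"
  have sum0: "(\<Sum>u\<in>{u\<in>?K. leaves u = M}. ?c u) = 0"
    using id by (rule identity_coefficient_sum)
  have outer: "outer_leaf u = None \<longleftrightarrow> size M \<noteq> 3" if "leaves u = M" for u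
    using that by (auto simp: outer_leaf_None_iff simp flip: size_leaves)
  show ?thesis
  proof (cases "(p = None) = (size M \<noteq> 3)")
    case False
    have "outer_leaf u \<noteq> p" if "leaves u = M" for u
      using False outer[OF that] by auto
    then have "{u\<in>?K. leaves u = M \<and> outer_leaf u = p} = {}" by blast
    then show ?thesis by (simp only: sum.empty)
  next
    case True
    show ?thesis
    proof (cases p)
      case None
      have "outer_leaf u = p" if "leaves u = M" for u
        using True None outer[OF that] by simp
      then have "{u\<in>?K. leaves u = M \<and> outer_leaf u = p} = {u\<in>?K. leaves u = M}" by blast
      then show ?thesis using sum0 by (simp only:)
    next
      case (Some m)
      let ?y = "\<lambda>i. if i = m then 1 else 0 :: 'k"
      have top_val: "(case outer_leaf u of None \<Rightarrow> 0 | Some k \<Rightarrow> (\<Sum>i\<in>#leaves u. ?y i) - 3 * ?y k)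
          = (\<Sum>i\<in>#M. ?y i) - 3 * (if outer_leaf u = p then 1 else 0)" if "leaves u = M" for u
        using that outer[OF that] True Some by (cases "outer_leaf u") auto
      let ?s = "\<Sum>i\<in>#M. ?y i" and ?U = "{u\<in>?K. leaves u = M}"
      have "0 = (\<Sum>u\<in>?U. ?c u * (case outer_leaf u of None \<Rightarrow> 0
          | Some k \<Rightarrow> (\<Sum>i\<in>#leaves u. ?y i) - 3 * ?y k))"
        using identity_outer_leaf_relation[OF assms, where M = M and y = ?y] by (rule sym)
      also have "\<dots> = (\<Sum>u\<in>?U. ?c u * ?s - 3 * (if outer_leaf u = p then ?c u else 0))"
      proof (rule sum.cong)
        fix u
        assume "u \<in> ?U"
        then show "?c u * (case outer_leaf u of None \<Rightarrow> 0
            | Some k \<Rightarrow> (\<Sum>i\<in>#leaves u. ?y i) - 3 * ?y k) =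
          ?c u * ?s - 3 * (if outer_leaf u = p then ?c u else 0)"
          by (subst top_val) (simp_all add: right_diff_distrib)
      qed simp
      also have "\<dots> = (\<Sum>u\<in>?U. ?c u) * ?s - 3 * (\<Sum>u\<in>?U. if outer_leaf u = p then ?c u else 0)"
        by (simp only: sum_subtractf sum_distrib_left sum_distrib_right)
      also have "(\<Sum>u\<in>?U. if outer_leaf u = p then ?c u else 0)
          = (\<Sum>u\<in>{u\<in>?U. outer_leaf u = p}. ?c u)"
        by (rule sum.inter_filter[symmetric]) simp
      also have "{u\<in>?U. outer_leaf u = p} = {u\<in>?K. leaves u = M \<and> outer_leaf u = p}" by auto
      finally show ?thesis unfolding sum0 by simp
    qed
  qed
qed

section \<open>Words modulo the T-ideal\<close>

lemma T_ideal_hull: "T_ideal (T_ideal hull S)"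
  by (rule hull_in) (auto simp: T_ideal_def na_ideal_def na.subspace_def)

lemma na_ideal_hull_T_ideal: "na_ideal (T_ideal hull S)"
  using T_ideal_hull by (auto simp: T_ideal_def)

lemma subspace_follows_from: "na.subspace {f. follows_from f S}"
  using na_ideal_hull_T_ideal[of S] by (simp add: na_ideal_def follows_from_def)

lemma follows_from_mult:
  assumes "follows_from f S"
  shows "follows_from (f \<star> g) S" "follows_from (g \<star> f) S"
  using assms na_ideal_hull_T_ideal[of S] by (auto simp: na_ideal_def follows_from_def)

lemma follows_from_substitution:
  "f \<in> S \<Longrightarrow> follows_from (na_eval na_scale (\<star>) \<sigma> f) S"
  using T_ideal_hull[of S] hull_inc[of f S T_ideal] by (auto simp: T_ideal_def follows_from_def)

definition word_poly :: "'v magma \<Rightarrow> ('v, 'k::zero_neq_one) nonassoc" where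
  "word_poly u = Poly_Mapping.single u 1"

lemma word_poly_Node:
  "(word_poly (Node u v) :: ('v, 'k::field) nonassoc) = word_poly u \<star> word_poly v"
  by (simp add: word_poly_def na_mult_superset[of "{u}" "{v}"])

text \<open>The coset of a word modulo the T-ideal. Congruence of words becomes equality of cosets, which can
  be used for rewriting.\<close>

definition word_class :: "nat magma \<Rightarrow> (nat, 'k::field) nonassoc set" where
  "word_class u = {g. follows_from (word_poly u - g) as3_plus_identities}"

lemma word_class_eq_iff:
  "(word_class u :: (nat, 'k::field) nonassoc set) = word_class v \<longleftrightarrow>
    follows_from (word_poly u - word_poly v :: (nat, 'k) nonassoc) as3_plus_identities"
proof -
  let ?S = "as3_plus_identities :: (nat, 'k) nonassoc set"
  let ?u = "word_poly u :: (nat, 'k) nonassoc" and ?v = "word_poly v :: (nat, 'k) nonassoc"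
  note sub = subspace_follows_from[of ?S]
  show ?thesis
  proof
    assume "(word_class u :: (nat, 'k) nonassoc set) = word_class v"
    moreover have "?v \<in> word_class v"
      using na.subspace_0[OF sub] by (simp add: word_class_def)
    ultimately have "?v \<in> word_class u" by simp
    then show "follows_from (?u - ?v) ?S" by (simp add: word_class_def)
  next
    assume eq: "follows_from (?u - ?v) ?S"
    have "follows_from (?u - g) ?S \<longleftrightarrow> follows_from (?v - g) ?S" for g
      using na.subspace_add[OF sub, of "?u - ?v" "?v - g"]
        na.subspace_diff[OF sub, of "?u - g" "?u - ?v"] eq by auto
    then show "(word_class u :: (nat, 'k) nonassoc set) = word_class v"
      by (auto simp: word_class_def)
  qed
qed

lemma word_class_Node_cong:
  assumes "(word_class u :: (nat, 'k::field) nonassoc set) = word_class u'"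
    and "(word_class v :: (nat, 'k) nonassoc set) = word_class v'"
  shows "(word_class (Node u v) :: (nat, 'k) nonassoc set) = word_class (Node u' v')"
proof -
  let ?p = "word_poly :: nat magma \<Rightarrow> (nat, 'k) nonassoc"
  have "?p (Node u v) - ?p (Node u' v') = (?p u - ?p u') \<star> ?p v + ?p u' \<star> (?p v - ?p v')"
    by (simp add: word_poly_Node na_mult_diff_left na_mult_diff_right)
  moreover have "follows_from ((?p u - ?p u') \<star> ?p v) as3_plus_identities"
    "follows_from (?p u' \<star> (?p v - ?p v')) as3_plus_identities"
    using assms by (auto simp: word_class_eq_iff intro: follows_from_mult)
  ultimately show ?thesis
    using na.subspace_add[OF subspace_follows_from]
    by (simp only: word_class_eq_iff mem_Collect_eq)
qed

lemma word_class_identities: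
  fixes a b c d :: "nat magma"
  defines "C \<equiv> word_class :: nat magma \<Rightarrow> (nat, 'k::field) nonassoc set"
  shows "C (Node a b) = C (Node b a)"
    and "C (Node (Node (Node a b) c) d) = C (Node (Node (Node a c) b) d)"
    and "C (Node (Node (Node a b) c) d) = C (Node (Node (Node a b) d) c)"
    and "C (Node (Node (Node a b) d) c) = C (Node (Node a b) (Node c d))"
proof -
  let ?\<sigma> = "\<lambda>i :: nat. word_poly ([a, b, c, d] ! i) :: (nat, 'k) nonassoc"
  note subst = follows_from_substitution[of _ as3_plus_identities ?\<sigma>]
  let ?x = "\<lambda>i. na_var i :: (nat, 'k) nonassoc"
  have "follows_from (na_eval na_scale (\<star>) ?\<sigma> (?x 0 \<star> ?x 1 - ?x 1 \<star> ?x 0)) as3_plus_identities"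
    and "follows_from (na_eval na_scale (\<star>) ?\<sigma>
      (((?x 0 \<star> ?x 1) \<star> ?x 2) \<star> ?x 3 - ((?x 0 \<star> ?x 2) \<star> ?x 1) \<star> ?x 3)) as3_plus_identities"
    and "follows_from (na_eval na_scale (\<star>) ?\<sigma>
      (((?x 0 \<star> ?x 1) \<star> ?x 2) \<star> ?x 3 - ((?x 0 \<star> ?x 1) \<star> ?x 3) \<star> ?x 2)) as3_plus_identities"
    and "follows_from (na_eval na_scale (\<star>) ?\<sigma>
      (((?x 0 \<star> ?x 1) \<star> ?x 3) \<star> ?x 2 - (?x 0 \<star> ?x 1) \<star> (?x 2 \<star> ?x 3))) as3_plus_identities"
    by (intro subst; simp add: as3_plus_identities_def Let_def)+
  then show "C (Node a b) = C (Node b a)"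
    "C (Node (Node (Node a b) c) d) = C (Node (Node (Node a c) b) d)"
    "C (Node (Node (Node a b) c) d) = C (Node (Node (Node a b) d) c)"
    "C (Node (Node (Node a b) d) c) = C (Node (Node a b) (Node c d))"
    by (simp_all add: C_def word_class_eq_iff word_poly_Node nonassoc.eval_simps)
qed

text \<open>Adjacent transpositions generate all permutations: move the first element of \<open>xs\<close> to the front of
  \<open>ys\<close> and append it to the fixed prefix \<open>ps\<close>. The length is fixed because the function below is
  symmetric on lists of length \<open>4\<close> only.\<close>

lemma eq_on_permutations:
  assumes swap: "\<And>us x y vs. length (us @ x # y # vs) = n \<Longrightarrow> G (us @ x # y # vs) = G (us @ y # x # vs)"
    and "length (ps @ xs) = n" "mset xs = mset ys"
  shows "G (ps @ xs) = G (ps @ ys)"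
  using assms(2,3)
proof (induction xs arbitrary: ps ys)
  case (Cons x xs)
  then have "x \<in> set ys" by (metis list.set_intros(1) mset_eq_setD)
  then obtain us vs where ys: "ys = us @ x # vs" by (meson split_list)
  have move: "length (qs @ us @ x # vs) = n \<Longrightarrow> G (qs @ us @ x # vs) = G (qs @ x # us @ vs)" for qs
  proof (induction us arbitrary: qs)
    case (Cons w us)
    then show ?case using Cons.IH[of "qs @ [w]"] swap[of qs w x "us @ vs"] by simp
  qed simp
  have len: "length (ps @ us @ x # vs) = n"
    using Cons.prems ys by (metis length_append mset_eq_length)
  have "G (ps @ x # xs) = G ((ps @ [x]) @ us @ vs)"
    using Cons.IH[of "ps @ [x]" "us @ vs"] Cons.prems ys by simp
  then show ?case using move[OF len] ys by simp
qed simp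

lemma word_class_commute:
  "(word_class (Node u v) :: (nat, 'k::field) nonassoc set) = word_class (Node v u)"
  by (rule word_class_identities(1))

lemma word_class_length_3:
  assumes "word_length u = 3"
  obtains i j k where "leaves u = {#i, j, k#}" "outer_leaf u = Some k"
    "(word_class u :: (nat, 'k::field) nonassoc set) = word_class (Node (Node (Leaf i) (Leaf j)) (Leaf k))"
proof -
  let ?C = "word_class :: nat magma \<Rightarrow> (nat, 'k) nonassoc set"
  consider (left) i j k where "u = Node (Node (Leaf i) (Leaf j)) (Leaf k)"
    | (right) i j k where "u = Node (Leaf k) (Node (Leaf i) (Leaf j))"
    using assms unfolding word_length_eq_3 by blast
  then show ?thesis
  proof cases
    case left
    then show ?thesis using that[of i j k] by simp
  next
    case right
    have "?C u = ?C (Node (Node (Leaf i) (Leaf j)) (Leaf k))"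
      unfolding right by (rule word_class_commute)
    then show ?thesis using that[of i j k] right by simp
  qed
qed

abbreviation left_normed4 :: "'v \<Rightarrow> 'v \<Rightarrow> 'v \<Rightarrow> 'v \<Rightarrow> 'v magma" where
  "left_normed4 i j k l \<equiv> Node (Node (Node (Leaf i) (Leaf j)) (Leaf k)) (Leaf l)"

lemma word_class_length_4:
  assumes "word_length u = 4"
  obtains i j k l where "leaves u = {#i, j, k, l#}"
    "(word_class u :: (nat, 'k::field) nonassoc set) = word_class (left_normed4 i j k l)"
proof -
  let ?C = "word_class :: nat magma \<Rightarrow> (nat, 'k) nonassoc set"
  from assms show ?thesis
  proof (cases u rule: word_length_eq_4_cases)
    case (two_two a b c d)
    have "?C (left_normed4 a b d c) = ?C u"
      unfolding two_two by (rule word_class_identities(4))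
    then show ?thesis using that[of a b d c] two_two by simp
  next
    case (three_one v d)
    obtain i j k where v: "leaves v = {#i, j, k#}"
      "?C v = ?C (Node (Node (Leaf i) (Leaf j)) (Leaf k))"
      using word_class_length_3[OF three_one(2)] .
    have "?C u = ?C (left_normed4 i j k d)"
      unfolding three_one(1) using v(2) by (rule word_class_Node_cong) simp
    then show ?thesis using that[of i j k d] three_one(1) v(1) by simp
  next
    case (one_three v d)
    obtain i j k where v: "leaves v = {#i, j, k#}"
      "?C v = ?C (Node (Node (Leaf i) (Leaf j)) (Leaf k))"
      using word_class_length_3[OF one_three(2)] .
    have "?C u = ?C (Node v (Leaf d))"
      unfolding one_three(1) by (rule word_class_commute)
    also have "\<dots> = ?C (left_normed4 i j k d)"
      using v(2) by (rule word_class_Node_cong) simp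
    finally show ?thesis using that[of i j k d] one_three(1) v(1) by simp
  qed
qed

text \<open>Commutativity and the first two identities of degree \<open>4\<close> are the three adjacent transpositions of
  the letters in \<open>((ij)k)l\<close>.\<close>

lemma word_class_left_normed4:
  assumes "{#i, j, k, l#} = {#i', j', k', l'#}"
  shows "(word_class (left_normed4 i j k l) :: (nat, 'k::field) nonassoc set) =
    word_class (left_normed4 i' j' k' l')"
proof -
  let ?C = "word_class :: nat magma \<Rightarrow> (nat, 'k) nonassoc set"
  let ?G = "\<lambda>xs :: nat list. ?C (left_normed4 (xs ! 0) (xs ! 1) (xs ! 2) (xs ! 3))"
  note ids = word_class_identities
  have "?G ([] @ [i, j, k, l]) = ?G ([] @ [i', j', k', l'])"
  proof (rule eq_on_permutations[where n = 4])
    fix us vs :: "nat list" and x y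
    assume len: "length (us @ x # y # vs) = 4"
    then consider c d where "us = []" "vs = [c, d]" | a d where "us = [a]" "vs = [d]"
      | a b where "us = [a, b]" "vs = []"
      by (cases us rule: remdups_adj.cases; cases vs rule: remdups_adj.cases) auto
    then show "?G (us @ x # y # vs) = ?G (us @ y # x # vs)"
    proof cases
      case (1 c d)
      have "?C (left_normed4 x y c d) = ?C (left_normed4 y x c d)"
        by (intro word_class_Node_cong ids(1)) simp_all
      then show ?thesis using 1 by (simp add: eval_nat_numeral)
    next
      case (2 a d)
      have "?C (left_normed4 a x y d) = ?C (left_normed4 a y x d)" by (rule ids(2))
      then show ?thesis using 2 by (simp add: eval_nat_numeral)
    next
      case (3 a b)
      have "?C (left_normed4 a b x y) = ?C (left_normed4 a b y x)" by (rule ids(3))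
      then show ?thesis using 3 by (simp add: eval_nat_numeral)
    qed
  qed (use assms in simp_all)
  then show ?thesis by (simp add: eval_nat_numeral)
qed

lemma word_class_determined:
  assumes "word_length u \<le> 4" "leaves u = leaves v" "outer_leaf u = outer_leaf v"
  shows "(word_class u :: (nat, 'k::field) nonassoc set) = word_class v"
proof -
  let ?C = "word_class :: nat magma \<Rightarrow> (nat, 'k) nonassoc set"
  have len: "word_length v = word_length u"
    using assms(2) by (metis size_leaves)
  consider "word_length u = 1" | "word_length u = 2" | "word_length u = 3" | "word_length u = 4"
    using assms(1) word_length_pos[of u] by linarith
  then show ?thesis
  proof cases
    case 1
    then obtain i i' where "u = Leaf i" "v = Leaf i'"
      using len word_length_eq_1[of u] word_length_eq_1[of v] by auto
    then show ?thesis using assms(2) by simp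
  next
    case 2
    then obtain i j i' j' where uv: "u = Node (Leaf i) (Leaf j)" "v = Node (Leaf i') (Leaf j')"
      using len word_length_eq_2[of u] word_length_eq_2[of v] by auto
    then have "i = i' \<and> j = j' \<or> i = j' \<and> j = i'"
      using assms(2) by (auto simp: add_eq_conv_ex)
    then show ?thesis
      unfolding uv by (elim disjE conjE) (simp_all only: word_class_commute)
  next
    case 3
    obtain i j k where u: "leaves u = {#i, j, k#}" "outer_leaf u = Some k"
      "?C u = ?C (Node (Node (Leaf i) (Leaf j)) (Leaf k))"
      using word_class_length_3[OF 3] .
    obtain i' j' k' where v: "leaves v = {#i', j', k'#}" "outer_leaf v = Some k'"
      "?C v = ?C (Node (Node (Leaf i') (Leaf j')) (Leaf k'))"
      using word_class_length_3[of v, unfolded len, OF 3] .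
    have k: "k = k'" using u v assms(3) by simp
    have "leaves u = {#i, j#} + {#k#}" "leaves v = {#i', j'#} + {#k#}"
      using u(1) v(1) k by simp_all
    then have "{#i, j#} + {#k#} = {#i', j'#} + {#k#}" using assms(2) by (simp only:)
    then have "{#i, j#} = {#i', j'#}" by (rule add_right_imp_eq)
    then have "i = i' \<and> j = j' \<or> i = j' \<and> j = i'" by (auto simp: add_eq_conv_ex)
    then have "?C (Node (Leaf i) (Leaf j)) = ?C (Node (Leaf i') (Leaf j'))"
      by (elim disjE conjE) (simp_all only: word_class_commute)
    then have "?C (Node (Node (Leaf i) (Leaf j)) (Leaf k)) = ?C (Node (Node (Leaf i') (Leaf j')) (Leaf k'))"
      by (rule word_class_Node_cong) (simp add: k)
    then show ?thesis using u(3) v(3) by simp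
  next
    case 4
    obtain i j k l where u: "leaves u = {#i, j, k, l#}" "?C u = ?C (left_normed4 i j k l)"
      using word_class_length_4[OF 4] .
    obtain i' j' k' l' where v: "leaves v = {#i', j', k', l'#}" "?C v = ?C (left_normed4 i' j' k' l')"
      using word_class_length_4[of v, unfolded len, OF 4] .
    have "?C (left_normed4 i j k l) = ?C (left_normed4 i' j' k' l')"
      by (rule word_class_left_normed4) (use u(1) v(1) assms(2) in simp)
    then show ?thesis using u(2) v(2) by simp
  qed
qed

text \<open>Choose a representative \<open>w\<close> of each class of words. Since the coefficients \<open>c u\<close> of the class add up
  to zero, its part of \<open>f\<close> is the sum of the terms \<open>c u (u - w)\<close>, each of which lies in the T-ideal.\<close>

lemma follows_from_class_sums_zero:
  fixes f :: "(nat, 'k::field) nonassoc"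
  assumes "na_degree_le f 4"
    and zero: "\<And>M p. (\<Sum>u\<in>{u\<in>Poly_Mapping.keys f. leaves u = M \<and> outer_leaf u = p}.
      Poly_Mapping.lookup f u) = 0"
  shows "follows_from f as3_plus_identities"
proof -
  let ?K = "Poly_Mapping.keys f" and ?c = "Poly_Mapping.lookup f"
  let ?p = "word_poly :: nat magma \<Rightarrow> (nat, 'k) nonassoc"
  let ?n = "\<lambda>u :: nat magma. (leaves u, outer_leaf u)"
  let ?T = "{g :: (nat, 'k) nonassoc. follows_from g as3_plus_identities}"
  note sub = subspace_follows_from[of "as3_plus_identities :: (nat, 'k) nonassoc set"]
  have "(\<Sum>u\<in>{u\<in>?K. ?n u = q}. na_scale (?c u) (?p u)) \<in> ?T" if "q \<in> ?n ` ?K" for q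
  proof -
    from that obtain w where w: "w \<in> ?K" "q = ?n w" by blast
    let ?U = "{u\<in>?K. ?n u = q}"
    have "(\<Sum>u\<in>?U. ?c u) = 0" using zero[of "leaves w" "outer_leaf w"] w(2) by simp
    then have "(\<Sum>u\<in>?U. na_scale (?c u) (?p w)) = 0"
      by (simp flip: na.scale_sum_left)
    then have "(\<Sum>u\<in>?U. na_scale (?c u) (?p u)) = (\<Sum>u\<in>?U. na_scale (?c u) (?p u - ?p w))"
      by (simp add: na.scale_right_diff_distrib sum_subtractf)
    also have "\<dots> \<in> ?T"
    proof (intro na.subspace_sum[OF sub] na.subspace_scale[OF sub])
      fix u assume "u \<in> ?U"
      then have "(word_class u :: (nat, 'k) nonassoc set) = word_class w"
        using assms(1) w by (intro word_class_determined) (auto simp: na_degree_le_def)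
      then show "?p u - ?p w \<in> ?T" by (simp add: word_class_eq_iff)
    qed
    finally show ?thesis .
  qed
  then have "(\<Sum>q\<in>?n ` ?K. \<Sum>u\<in>{u\<in>?K. ?n u = q}. na_scale (?c u) (?p u)) \<in> ?T"
    by (rule na.subspace_sum[OF sub])
  also have "(\<Sum>q\<in>?n ` ?K. \<Sum>u\<in>{u\<in>?K. ?n u = q}. na_scale (?c u) (?p u))
      = (\<Sum>u\<in>?K. na_scale (?c u) (?p u))"
    by (rule sum.image_gen[symmetric]) simp
  also have "\<dots> = f"
    by (rule poly_mapping_eqI)
      (simp add: lookup_sum word_poly_def lookup_single when_def in_keys_iff sum.If_cases
        if_distrib cong: if_cong)
  finally show ?thesis by (simp only: mem_Collect_eq)
qed

theorem theorem8:
  assumes "\<exists>x y :: 'x. x \<noteq> y"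
  shows "(\<forall>f \<in> as3_plus_identities.
            is_identity as3_scale (anticomm :: ('x, 'k::field_char_0) as3 \<Rightarrow> _) f) \<and>
         (\<forall>f. is_identity as3_scale (anticomm :: ('x, 'k) as3 \<Rightarrow> _) f \<and> na_degree_le f 4
            \<longrightarrow> follows_from f as3_plus_identities)"
proof (intro conjI ballI allI impI)
  show "is_identity as3_scale (anticomm :: ('x, 'k) as3 \<Rightarrow> _) f" if "f \<in> as3_plus_identities" for f
    using that by (rule as3_plus_satisfies)
next
  fix f :: "(nat, 'k) nonassoc"
  assume f: "is_identity as3_scale (anticomm :: ('x, 'k) as3 \<Rightarrow> _) f \<and> na_degree_le f 4"
  obtain x x' :: 'x where "x \<noteq> x'" using assms by blast
  with f show "follows_from f as3_plus_identities"
    by (intro follows_from_class_sums_zero identity_class_sum_zero) auto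
qed

end
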